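(* Let $0<q<p$ be real. For every integer $n\ge0$ and every $s>0$, $$\mathcal L_{p,q}\{t^n\}(s)=\frac{[n]_{p,q}!}{q^{\binom{n+1}2}s^{n+1}}.$$
   Context: Let $0<q<p$ be real numbers. For an integer $n\ge 0$, $[n]_{p,q}=\frac{p^n-q^n}{p-q}$, $[n]_{p,q}!=\prod_{k=1}^n[k]_{p,q}$, $[0]_{p,q}!=1$. The $(p,q)$-exponentials are $E_{p,q}(z)=\sum_{n\ge0}\frac{q^{\binom n2}}{[n]_{p,q}!}z^n$ (entire) and $e_{p,q}(z)=\sum_{n\ge0}\frac{p^{\binom n2}}{[n]_{p,q}!}z^n$; the latter series converges for $|z|<p/(p-q)$ and $e_{p,q}$ is extended meromorphically to $\mathbb C$ by $e_{p,q}(z)=1/E_{p,q}(-z)$. The improper $(p,q)$-integral of $f$ is $\int_0^\infty f(x)\,d_{p,q}x=(p-q)\sum_{j=-\infty}^{\infty}\frac{q^j}{p^{j+1}}f\!\left(\frac{q^j}{p^{j+1}}\right)$; it converges if both the sum over $j\ge0$ and the sum over $j<0$ converge. The $(p,q)$-Laplace transform of the second kind is $\mathcal L_{p,q}\{f(t)\}(s)=\int_0^\infty f(t)e_{p,q}(-pts)\,d_{p,q}t$, $s>0$. *)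

theory Defs
  imports Complex_Main
begin

definition pq_number :: "real \<Rightarrow> real \<Rightarrow> nat \<Rightarrow> real" where
  "pq_number p q n = (p ^ n - q ^ n) / (p - q)"

definition pq_fact :: "real \<Rightarrow> real \<Rightarrow> nat \<Rightarrow> real" where
  "pq_fact p q n = (\<Prod>k=1..n. pq_number p q k)"

definition pq_E :: "real \<Rightarrow> real \<Rightarrow> complex \<Rightarrow> complex" where
  "pq_E p q z = (\<Sum>n. complex_of_real (q ^ (n choose 2) / pq_fact p q n) * z ^ n)"

text \<open>For \<open>0 < q < p\<close> the power series below has radius of convergence \<open>p / (p - q)\<close>; outside
  that disc the function is given by its meromorphic continuation \<open>1 / E(-z)\<close> (with the value 0
  at the poles, by the convention for division by zero).\<close>

definition pq_e :: "real \<Rightarrow> real \<Rightarrow> complex \<Rightarrow> complex" where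
  "pq_e p q z =
     (if cmod z < p / (p - q)
      then (\<Sum>n. complex_of_real (p ^ (n choose 2) / pq_fact p q n) * z ^ n)
      else 1 / pq_E p q (- z))"

definition pq_node :: "real \<Rightarrow> real \<Rightarrow> int \<Rightarrow> real" where
  "pq_node p q j = q powi j / p powi (j + 1)"

definition pq_term :: "real \<Rightarrow> real \<Rightarrow> (real \<Rightarrow> complex) \<Rightarrow> int \<Rightarrow> complex" where
  "pq_term p q f j = complex_of_real (pq_node p q j) * f (pq_node p q j)"

text \<open>The bilateral sum over \<open>j\<close> is split into \<open>j \<ge> 0\<close> and \<open>j < 0\<close>, the latter enumerated as
  \<open>j = - int k - 1\<close>. As the value of a divergent integral is unspecified, statements about
  \<open>pq_integral\<close> should be paired with \<open>pq_integrable\<close>.\<close>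

definition pq_integrable :: "real \<Rightarrow> real \<Rightarrow> (real \<Rightarrow> complex) \<Rightarrow> bool" where
  "pq_integrable p q f \<longleftrightarrow>
     summable (\<lambda>k::nat. pq_term p q f (int k)) \<and>
     summable (\<lambda>k::nat. pq_term p q f (- int k - 1))"

definition pq_integral :: "real \<Rightarrow> real \<Rightarrow> (real \<Rightarrow> complex) \<Rightarrow> complex" where
  "pq_integral p q f =
     complex_of_real (p - q) *
       ((\<Sum>k::nat. pq_term p q f (int k)) + (\<Sum>k::nat. pq_term p q f (- int k - 1)))"

definition pq_laplace_integrand ::
    "real \<Rightarrow> real \<Rightarrow> (real \<Rightarrow> complex) \<Rightarrow> real \<Rightarrow> real \<Rightarrow> complex" where
  "pq_laplace_integrand p q f s t = f t * pq_e p q (complex_of_real (- (p * t * s)))"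

definition pq_laplace :: "real \<Rightarrow> real \<Rightarrow> (real \<Rightarrow> complex) \<Rightarrow> real \<Rightarrow> complex" where
  "pq_laplace p q f s = pq_integral p q (pq_laplace_integrand p q f s)"

end

theory Submission imports Defs begin

text \<open>With \<open>r = q / p\<close>, comparing coefficients gives \<open>E(z) = (1 + (1 - r) z) E(r z)\<close> and
  \<open>e(r z) = (1 - (1 - r) z) e(z)\<close>. Hence \<open>e(z) E(-z)\<close> is invariant under \<open>z \<mapsto> r z\<close>, so by
  continuity at 0 it equals 1, and \<open>e(-z) = 1 / E(z)\<close> everywhere. At the nodes \<open>x j\<close> the first
  equation says that \<open>G j = 1 / E(p s (x j))\<close> satisfies
  \<open>G (j + 1) - G j = (p - q) s (x j) (G j)\<close>. For \<open>n = 0\<close> the integral telescopes, since \<open>E(x) \<ge> 1 + x\<close>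
  for \<open>x \<ge> 0\<close>; multiplying by \<open>(x j) ^ (n + 1)\<close> and shifting \<open>j\<close> gives the recursion in \<open>n\<close>.\<close>

section \<open>The exponential series\<close>

definition pq_E_coeff :: "real \<Rightarrow> real \<Rightarrow> nat \<Rightarrow> real" where
  "pq_E_coeff p q n = q ^ (n choose 2) / pq_fact p q n"

definition pq_e_coeff :: "real \<Rightarrow> real \<Rightarrow> nat \<Rightarrow> real" where
  "pq_e_coeff p q n = p ^ (n choose 2) / pq_fact p q n"

text \<open>The bare power series, without the case distinction of \<open>pq_e\<close>, so that it
  can be compared with \<open>pq_E\<close> inside its disc before the two branches are
  merged.\<close>

definition pq_e_series :: "real \<Rightarrow> real \<Rightarrow> complex \<Rightarrow> complex" where
  "pq_e_series p q z = (\<Sum>n. complex_of_real (pq_e_coeff p q n) * z ^ n)"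

lemma pq_E_eq: "pq_E p q z = (\<Sum>n. complex_of_real (pq_E_coeff p q n) * z ^ n)"
  by (simp add: pq_E_def pq_E_coeff_def)

section \<open>Positivity and recursions of the coefficients\<close>

lemma pq_number_pos:
  assumes "0 < q" "q < p" "0 < n"
  shows "0 < pq_number p q n"
  using assms by (simp add: pq_number_def power_strict_mono)

lemma pq_fact_0 [simp]: "pq_fact p q 0 = 1"
  by (simp add: pq_fact_def)

lemma pq_fact_Suc: "pq_fact p q (Suc n) = pq_number p q (Suc n) * pq_fact p q n"
  by (simp add: pq_fact_def mult.commute)

lemma pq_fact_pos:
  assumes "0 < q" "q < p"
  shows "0 < pq_fact p q n"
  by (induction n) (use assms in \<open>simp_all add: pq_fact_Suc pq_number_pos\<close>)

lemma Suc_choose_two: "Suc n choose 2 = (n choose 2) + n"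
  by (simp add: numeral_2_eq_2)

lemma pq_E_coeff_0 [simp]: "pq_E_coeff p q 0 = 1"
  by (simp add: pq_E_coeff_def binomial_eq_0)

lemma pq_e_coeff_0 [simp]: "pq_e_coeff p q 0 = 1"
  by (simp add: pq_e_coeff_def binomial_eq_0)

lemma pq_E_coeff_pos:
  assumes "0 < q" "q < p"
  shows "0 < pq_E_coeff p q n"
  using assms by (simp add: pq_E_coeff_def pq_fact_pos)

lemma pq_e_coeff_pos:
  assumes "0 < q" "q < p"
  shows "0 < pq_e_coeff p q n"
  using assms by (simp add: pq_e_coeff_def pq_fact_pos)

text \<open>With r = q/p, [n+1] = p^n (1 - r^(n+1)) / (1 - r), and the exponent n choose 2 grows by
  n, so consecutive coefficients have the ratio q^n / [n+1]. Clearing the denominator gives the form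
  that matches the series of E(z) - E(r z).\<close>

lemma pq_E_coeff_Suc:
  assumes "0 < q" "q < p"
  shows "(1 - (q/p) ^ Suc n) * pq_E_coeff p q (Suc n) = (1 - q/p) * (q/p) ^ n * pq_E_coeff p q n"
proof -
  have "p ^ Suc n - q ^ Suc n > 0"
    using assms power_strict_mono[of q p "Suc n"] by simp
  then show ?thesis
    using assms pq_fact_pos[OF assms, of n]
    by (simp add: pq_E_coeff_def pq_fact_Suc pq_number_def Suc_choose_two power_add
        power_divide divide_simps)
qed

lemma pq_e_coeff_Suc:
  assumes "0 < q" "q < p"
  shows "(1 - (q/p) ^ Suc n) * pq_e_coeff p q (Suc n) = (1 - q/p) * pq_e_coeff p q n"
proof -
  have "p ^ Suc n - q ^ Suc n > 0"
    using assms power_strict_mono[of q p "Suc n"] by simp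
  then show ?thesis
    using assms pq_fact_pos[OF assms, of n]
    by (simp add: pq_e_coeff_def pq_fact_Suc pq_number_def Suc_choose_two power_add
        power_divide divide_simps)
qed

section \<open>Convergence of the two series\<close>

text \<open>Ratio test with the ratio given as a sequence \<open>\<rho>\<close> instead of a
  quotient of terms, so that vanishing terms (z = 0) fit in as well.\<close>

lemma summable_ratio_limit:
  fixes f :: "nat \<Rightarrow> 'a::banach"
  assumes "\<And>n. norm (f (Suc n)) = \<rho> n * norm (f n)" "\<rho> \<longlonglongrightarrow> L" "L < 1"
  shows "summable f"
proof -
  obtain c where c: "L < c" "c < 1"
    using dense[OF assms(3)] by blast
  obtain N where "\<And>n. n \<ge> N \<Longrightarrow> \<rho> n < c"
    using order_tendstoD(2)[OF assms(2) c(1)] by (auto simp: eventually_sequentially)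
  then have "norm (f (Suc n)) \<le> c * norm (f n)" if "n \<ge> N" for n
    unfolding assms(1) using that by (intro mult_right_mono norm_ge_zero less_imp_le)
  then show ?thesis
    by (rule summable_ratio_test[OF c(2)])
qed

lemma one_minus_ratio_power_pos:
  fixes p q :: real
  assumes "0 < q" "q < p"
  shows "0 < 1 - (q/p) ^ Suc n"
  using assms by (simp add: power_Suc_less_one del: power_Suc)

text \<open>The ratio of consecutive terms carries the factor r^n and tends to 0 for every
  z.\<close>

lemma summable_pq_E:
  fixes z :: complex
  assumes "0 < q" "q < p"
  shows "summable (\<lambda>n. complex_of_real (pq_E_coeff p q n) * z ^ n)"
proof (rule summable_ratio_limit)
  let ?\<rho> = "\<lambda>n. (1 - q/p) * (q/p) ^ n / (1 - (q/p) ^ Suc n) * cmod z"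
  fix n
  have Suc: "pq_E_coeff p q (Suc n) = (1 - q/p) * (q/p) ^ n / (1 - (q/p) ^ Suc n) * pq_E_coeff p q n"
    using pq_E_coeff_Suc[OF assms, of n] one_minus_ratio_power_pos[OF assms, of n]
    by (simp add: eq_divide_eq mult.commute del: power_Suc)
  have norm: "norm (complex_of_real (pq_E_coeff p q k) * z ^ k) = pq_E_coeff p q k * cmod z ^ k" for k
    using pq_E_coeff_pos[OF assms, of k] by (simp add: norm_mult norm_power)
  show "norm (complex_of_real (pq_E_coeff p q (Suc n)) * z ^ Suc n) =
      ?\<rho> n * norm (complex_of_real (pq_E_coeff p q n) * z ^ n)"
    unfolding norm unfolding Suc power_Suc[of "cmod z"] by (simp only: mult_ac)
next
  have pow: "(\<lambda>n. (q/p) ^ n) \<longlonglongrightarrow> 0"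
    using assms by (intro LIMSEQ_realpow_zero) auto
  have "(\<lambda>n. (1 - q/p) * (q/p) ^ n / (1 - (q/p) ^ Suc n) * cmod z)
      \<longlonglongrightarrow> (1 - q/p) * 0 / (1 - 0) * cmod z"
    by (intro tendsto_intros pow LIMSEQ_Suc[OF pow]) simp
  then show "(\<lambda>n. (1 - q/p) * (q/p) ^ n / (1 - (q/p) ^ Suc n) * cmod z) \<longlonglongrightarrow> 0"
    by simp
qed simp

text \<open>Here the ratio tends to (1 - r) |z|, which is below 1 exactly when |z| < p / (p -
  q).\<close>

lemma summable_pq_e:
  fixes z :: complex
  assumes "0 < q" "q < p" "cmod z < p / (p - q)"
  shows "summable (\<lambda>n. complex_of_real (pq_e_coeff p q n) * z ^ n)"
proof (rule summable_ratio_limit)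
  let ?\<rho> = "\<lambda>n. (1 - q/p) / (1 - (q/p) ^ Suc n) * cmod z"
  fix n
  have Suc: "pq_e_coeff p q (Suc n) = (1 - q/p) / (1 - (q/p) ^ Suc n) * pq_e_coeff p q n"
    using pq_e_coeff_Suc[OF assms(1,2), of n] one_minus_ratio_power_pos[OF assms(1,2), of n]
    by (simp add: eq_divide_eq mult.commute del: power_Suc)
  have norm: "norm (complex_of_real (pq_e_coeff p q k) * z ^ k) = pq_e_coeff p q k * cmod z ^ k" for k
    using pq_e_coeff_pos[OF assms(1,2), of k] by (simp add: norm_mult norm_power)
  show "norm (complex_of_real (pq_e_coeff p q (Suc n)) * z ^ Suc n) =
      ?\<rho> n * norm (complex_of_real (pq_e_coeff p q n) * z ^ n)"
    unfolding norm unfolding Suc power_Suc[of "cmod z"] by (simp only: mult_ac)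
next
  have pow: "(\<lambda>n. (q/p) ^ n) \<longlonglongrightarrow> 0"
    using assms by (intro LIMSEQ_realpow_zero) auto
  have "(\<lambda>n. (1 - q/p) / (1 - (q/p) ^ Suc n) * cmod z)
      \<longlonglongrightarrow> (1 - q/p) / (1 - 0) * cmod z"
    by (intro tendsto_intros pow LIMSEQ_Suc[OF pow]) simp
  then show "(\<lambda>n. (1 - q/p) / (1 - (q/p) ^ Suc n) * cmod z) \<longlonglongrightarrow> (1 - q/p) * cmod z"
    by simp
  show "(1 - q/p) * cmod z < 1"
    using assms by (simp add: field_simps)
qed

section \<open>Functional equations and the reciprocal relation\<close>

lemma pq_E_scale:
  assumes "0 < q" "q < p"
  shows "pq_E p q z = (1 + (1 - of_real (q/p)) * z) * pq_E p q (of_real (q/p) * z)"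
proof -
  let ?r = "complex_of_real (q/p)" and ?b = "\<lambda>n. complex_of_real (pq_E_coeff p q n)"
  have coeff: "(1 - ?r ^ Suc n) * ?b (Suc n) = (1 - ?r) * ?r ^ n * ?b n" for n
    using arg_cong[OF pq_E_coeff_Suc[OF assms, of n], of complex_of_real] by simp
  have E: "(\<lambda>n. ?b n * w ^ n) sums pq_E p q w" for w
    using summable_sums[OF summable_pq_E[OF assms]] by (simp add: pq_E_eq)
  have "(\<lambda>n. ?b n * z ^ n - ?b n * (?r * z) ^ n) sums (pq_E p q z - pq_E p q (?r * z))"
    by (intro sums_diff E)
  \<comment> \<open>The terms at index 0 cancel, so the shift leaves the sum unchanged.\<close>
  then have "(\<lambda>n. ?b (Suc n) * z ^ Suc n - ?b (Suc n) * (?r * z) ^ Suc n)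
      sums (pq_E p q z - pq_E p q (?r * z))"
    by (subst sums_Suc_iff) simp
  moreover have "?b (Suc n) * z ^ Suc n - ?b (Suc n) * (?r * z) ^ Suc n
      = (1 - ?r) * z * (?b n * (?r * z) ^ n)" for n
  proof -
    have "?b (Suc n) * z ^ Suc n - ?b (Suc n) * (?r * z) ^ Suc n
        = ((1 - ?r ^ Suc n) * ?b (Suc n)) * z ^ Suc n"
      by (simp only: power_mult_distrib algebra_simps mult_1_left)
    then show ?thesis
      unfolding coeff by (simp only: power_mult_distrib power_Suc mult_ac)
  qed
  ultimately have "(\<lambda>n. (1 - ?r) * z * (?b n * (?r * z) ^ n))
      sums (pq_E p q z - pq_E p q (?r * z))"
    by simp
  from sums_unique2[OF this sums_mult[OF E]] show ?thesis
    by (simp add: algebra_simps)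
qed

text \<open>As for \<open>pq_E_scale\<close>, but the recursion lacks the factor r^n, so the
  difference is a multiple of e(z) instead of e(r z).\<close>

lemma pq_e_series_scale:
  assumes "0 < q" "q < p" "cmod z < p / (p - q)"
  shows "pq_e_series p q (of_real (q/p) * z) = (1 - (1 - of_real (q/p)) * z) * pq_e_series p q z"
proof -
  let ?r = "complex_of_real (q/p)" and ?a = "\<lambda>n. complex_of_real (pq_e_coeff p q n)"
  have coeff: "(1 - ?r ^ Suc n) * ?a (Suc n) = (1 - ?r) * ?a n" for n
    using arg_cong[OF pq_e_coeff_Suc[OF assms(1,2), of n], of complex_of_real] by simp
  have e: "(\<lambda>n. ?a n * w ^ n) sums pq_e_series p q w" if "cmod w < p / (p - q)" for w
    using summable_sums[OF summable_pq_e[OF assms(1,2) that]] by (simp add: pq_e_series_def)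
  have "cmod (?r * z) \<le> 1 * cmod z"
    unfolding norm_mult using assms by (intro mult_right_mono) (auto simp: norm_divide)
  then have "cmod (?r * z) < p / (p - q)"
    using assms(3) by linarith
  then have "(\<lambda>n. ?a n * z ^ n - ?a n * (?r * z) ^ n)
      sums (pq_e_series p q z - pq_e_series p q (?r * z))"
    using assms(3) by (intro sums_diff e)
  then have "(\<lambda>n. ?a (Suc n) * z ^ Suc n - ?a (Suc n) * (?r * z) ^ Suc n)
      sums (pq_e_series p q z - pq_e_series p q (?r * z))"
    by (subst sums_Suc_iff) simp
  moreover have "?a (Suc n) * z ^ Suc n - ?a (Suc n) * (?r * z) ^ Suc n
      = (1 - ?r) * z * (?a n * z ^ n)" for n
  proof -
    have "?a (Suc n) * z ^ Suc n - ?a (Suc n) * (?r * z) ^ Suc n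
        = ((1 - ?r ^ Suc n) * ?a (Suc n)) * z ^ Suc n"
      by (simp only: power_mult_distrib algebra_simps mult_1_left)
    then show ?thesis
      unfolding coeff by (simp only: power_Suc mult_ac)
  qed
  ultimately have "(\<lambda>n. (1 - ?r) * z * (?a n * z ^ n))
      sums (pq_e_series p q z - pq_e_series p q (?r * z))"
    by simp
  from sums_unique2[OF this sums_mult[OF e[OF assms(3)]]] show ?thesis
    by (simp add: algebra_simps)
qed

section \<open>Continuity and the product relation\<close>

lemma pq_E_0 [simp]: "pq_E p q 0 = 1"
  by (simp add: pq_E_eq)

lemma pq_e_series_0 [simp]: "pq_e_series p q 0 = 1"
  by (simp add: pq_e_series_def)

lemma isCont_pq_E:
  assumes "0 < q" "q < p"
  shows "isCont (pq_E p q) z"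
proof -
  have "isCont (\<lambda>x. \<Sum>n. complex_of_real (pq_E_coeff p q n) * x ^ n) z"
    by (rule isCont_powser[OF summable_pq_E[OF assms, of "of_real (cmod z + 1)"]]) simp
  then show ?thesis
    by (simp add: pq_E_eq[abs_def])
qed

lemma isCont_pq_e_series_0:
  assumes "0 < q" "q < p"
  shows "isCont (pq_e_series p q) 0"
proof -
  have "isCont (\<lambda>x. \<Sum>n. complex_of_real (pq_e_coeff p q n) * x ^ n) 0"
    \<comment> \<open>The point 1 lies in the disc of convergence, since p - q < p.\<close>
    by (rule isCont_powser[OF summable_pq_e[OF assms, of 1]]) (use assms in \<open>simp_all add: field_simps\<close>)
  then show ?thesis
    by (simp add: pq_e_series_def[abs_def])
qed

lemma pq_e_series_mult_pq_E:
  assumes "0 < q" "q < p" "cmod z < p / (p - q)"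
  shows "pq_e_series p q z * pq_E p q (- z) = 1"
proof -
  let ?r = "complex_of_real (q/p)" and ?h = "\<lambda>z. pq_e_series p q z * pq_E p q (- z)"
  have r: "cmod ?r < 1"
    using assms by (simp add: norm_divide)
  have invariant: "?h (?r ^ n * z) = ?h z" for n
  proof (induction n)
    case (Suc n)
    have "cmod (?r ^ n * z) \<le> 1 * cmod z"
      unfolding norm_mult norm_power using r by (intro mult_right_mono power_le_one) auto
    then have "cmod (?r ^ n * z) < p / (p - q)"
      using assms(3) by linarith
    \<comment> \<open>With w = r^n z, the factor 1 - (1 - r) w that e(r w) produces is the one that
      turns E(-r w) into E(-w).\<close>
    from pq_e_series_scale[OF assms(1,2) this] pq_E_scale[OF assms(1,2), of "- (?r ^ n * z)"]
    have "?h (?r * (?r ^ n * z)) = ?h (?r ^ n * z)"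
      by simp
    with Suc show ?case
      by (simp add: mult.assoc)
  qed simp
  have "(\<lambda>n. ?r ^ n * z) \<longlonglongrightarrow> 0"
    using tendsto_mult_left_zero[OF LIMSEQ_power_zero[OF r]] by simp
  moreover have "isCont ?h 0"
    by (intro continuous_intros isCont_pq_e_series_0 isCont_o2[OF _ isCont_pq_E] assms)
  ultimately have "(\<lambda>n. ?h (?r ^ n * z)) \<longlonglongrightarrow> ?h 0"
    by (rule isCont_tendsto_compose[rotated])
  \<comment> \<open>The convergent sequence is constant, so \<open>?h z\<close> equals its limit
    \<open>?h 0\<close>, which is 1.\<close>
  then show ?thesis
    unfolding invariant by (simp add: LIMSEQ_const_iff)
qed

text \<open>Inside the disc the product relation also shows E(-z) \<noteq> 0; outside, the equation
  is the definition, with 0 on both sides at a pole.\<close>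

lemma pq_e_eq:
  assumes "0 < q" "q < p"
  shows "pq_e p q z = 1 / pq_E p q (- z)"
proof (cases "cmod z < p / (p - q)")
  case True
  then have "pq_e p q z = pq_e_series p q z"
    by (simp add: pq_e_def pq_e_series_def pq_e_coeff_def)
  moreover have "pq_e_series p q z * pq_E p q (- z) = 1"
    by (rule pq_e_series_mult_pq_E[OF assms True])
  moreover from this have "pq_E p q (- z) \<noteq> 0"
    by auto
  ultimately show ?thesis
    by (simp add: eq_divide_eq)
qed (simp add: pq_e_def)

text \<open>All terms are nonnegative and the first two are 1 and x. The bound gives both E \<noteq>
  0 at the nodes and the decay of 1 / E at infinity.\<close>

lemma norm_pq_E_ge:
  assumes "0 < q" "q < p" "0 \<le> x"
  shows "1 + x \<le> cmod (pq_E p q (of_real x))"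
proof -
  let ?f = "\<lambda>n. pq_E_coeff p q n * x ^ n"
  have eq: "(\<lambda>n. complex_of_real (pq_E_coeff p q n) * of_real x ^ n) = (\<lambda>n. of_real (?f n))"
    by simp
  have nonneg: "0 \<le> ?f n" for n
    using assms(3) pq_E_coeff_pos[OF assms(1,2), of n] by simp
  have summable: "summable ?f"
    using summable_Re[OF summable_pq_E[OF assms(1,2), of "of_real x"]] unfolding eq by simp
  have E: "pq_E p q (of_real x) = of_real (suminf ?f)"
    unfolding pq_E_eq eq by (rule suminf_of_real[OF summable, symmetric])
  have "pq_E_coeff p q (Suc 0) = 1"
    using assms by (simp add: pq_E_coeff_def pq_fact_Suc pq_number_def numeral_2_eq_2)
  then have "1 + x = (\<Sum>n<2. ?f n)"
    by (simp add: numeral_2_eq_2)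
  also have "\<dots> \<le> suminf ?f"
    by (intro sum_le_suminf summable finite_lessThan nonneg)
  finally show ?thesis
    unfolding E norm_of_real by linarith
qed

section \<open>Bilateral sums\<close>

text \<open>Follows the split in \<open>pq_integrable\<close> and bundles convergence of both halves
  with the value, so that integrability is carried along with each computation.\<close>

definition has_bilateral_sum :: "(int \<Rightarrow> 'a::real_normed_vector) \<Rightarrow> 'a \<Rightarrow> bool" where
  "has_bilateral_sum f S \<longleftrightarrow>
     (\<exists>a b. (\<lambda>k. f (int k)) sums a \<and> (\<lambda>k. f (- int k - 1)) sums b \<and> S = a + b)"

lemma has_bilateral_sum_diff:
  assumes "has_bilateral_sum f S" "has_bilateral_sum g T"
  shows "has_bilateral_sum (\<lambda>j. f j - g j) (S - T)"
proof -
  obtain a b where "(\<lambda>k. f (int k)) sums a" "(\<lambda>k. f (- int k - 1)) sums b" "S = a + b"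
    using assms(1) by (auto simp: has_bilateral_sum_def)
  moreover obtain c d where "(\<lambda>k. g (int k)) sums c" "(\<lambda>k. g (- int k - 1)) sums d" "T = c + d"
    using assms(2) by (auto simp: has_bilateral_sum_def)
  ultimately show ?thesis
    unfolding has_bilateral_sum_def
    by (intro exI[of _ "a - c"] exI[of _ "b - d"]) (auto intro: sums_diff)
qed

lemma has_bilateral_sum_mult:
  fixes c :: "'a::real_normed_algebra"
  assumes "has_bilateral_sum f S"
  shows "has_bilateral_sum (\<lambda>j. c * f j) (c * S)"
  using assms unfolding has_bilateral_sum_def by (metis sums_mult distrib_left)

lemma minus_int_Suc: "- int (Suc k) = - int k - 1"
  by simp

text \<open>The term \<open>f 0\<close> passes from the nonnegative half to the negative half, and
  the total stays the same.\<close>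

lemma has_bilateral_sum_shift:
  assumes "has_bilateral_sum f S"
  shows "has_bilateral_sum (\<lambda>j. f (j + 1)) S"
proof -
  obtain a b where ab: "(\<lambda>k. f (int k)) sums a" "(\<lambda>k. f (- int k - 1)) sums b" "S = a + b"
    using assms by (auto simp: has_bilateral_sum_def)
  have "(\<lambda>k. f (int (Suc k))) sums (a - f 0)"
    using ab(1) by (subst sums_Suc_iff) simp
  moreover have "(\<lambda>k. f (- int k)) sums (b + f 0)"
    using sums_Suc[of "\<lambda>k. f (- int k)" b] ab(2) unfolding minus_int_Suc by simp
  ultimately show ?thesis
    unfolding has_bilateral_sum_def
    by (intro exI[of _ "a - f 0"] exI[of _ "b + f 0"]) (auto simp: ab(3) add.commute)
qed

text \<open>Both halves telescope to the common boundary value \<open>g 0\<close>, which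
  cancels.\<close>

lemma has_bilateral_sum_telescope:
  assumes "(\<lambda>k. g (int k)) \<longlonglongrightarrow> L" "(\<lambda>k. g (- int k)) \<longlonglongrightarrow> M"
  shows "has_bilateral_sum (\<lambda>j. g (j + 1) - g j) (L - M)"
proof -
  have "(\<lambda>k. g (int k + 1) - g (int k)) sums (L - g 0)"
    using telescope_sums[OF assms(1)] by (simp add: add.commute)
  moreover have "(\<lambda>k. g (- int k - 1 + 1) - g (- int k - 1)) sums (g 0 - M)"
    using telescope_sums'[OF assms(2)] unfolding minus_int_Suc by simp
  ultimately show ?thesis
    unfolding has_bilateral_sum_def
    by (intro exI[of _ "L - g 0"] exI[of _ "g 0 - M"]) simp
qed

section \<open>The Laplace transform of powers\<close>

text \<open>The sequence \<open>G j\<close> of the overview: by \<open>pq_e_eq\<close> it is the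
  Laplace kernel e(-p t s) at the node t = x j.\<close>

definition pq_node_recip_E :: "real \<Rightarrow> real \<Rightarrow> real \<Rightarrow> int \<Rightarrow> complex" where
  "pq_node_recip_E p q s j = 1 / pq_E p q (of_real (p * s * pq_node p q j))"

section \<open>The kernel on the geometric grid of nodes\<close>

lemma pq_node_eq:
  assumes "0 < q" "q < p"
  shows "pq_node p q j = (q/p) powi j / p"
  using assms by (simp add: pq_node_def power_int_divide_distrib power_int_add)

lemma pq_node_pos:
  assumes "0 < q" "q < p"
  shows "0 < pq_node p q j"
  using assms by (simp add: pq_node_def)

lemma pq_node_add_one:
  assumes "0 < q" "q < p"
  shows "pq_node p q (j + 1) = (q/p) * pq_node p q j"
  using assms by (simp add: pq_node_eq power_int_add)

text \<open>Since x (j + 1) = r x j, \<open>pq_E_scale\<close> links E at neighbouring nodes, and p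
  (1 - r) = p - q; then take reciprocals.\<close>

lemma pq_node_recip_E_diff:
  assumes "0 < q" "q < p" "0 < s"
  shows "pq_node_recip_E p q s (j + 1) - pq_node_recip_E p q s j =
    of_real ((p - q) * s * pq_node p q j) * pq_node_recip_E p q s j"
proof -
  let ?x = "pq_node p q j" and ?E = "\<lambda>j. pq_E p q (of_real (p * s * pq_node p q j))"
  have nonzero: "?E i \<noteq> 0" for i
    using norm_pq_E_ge[OF assms(1,2), of "p * s * pq_node p q i"] pq_node_pos[OF assms(1,2), of i] assms
    by (smt (verit) mult_pos_pos norm_zero)
  have "?E j = (1 + (1 - of_real (q/p)) * of_real (p * s * ?x)) * ?E (j + 1)"
    using pq_E_scale[OF assms(1,2), of "of_real (p * s * ?x)"]
    by (simp add: pq_node_add_one[OF assms(1,2)] mult_ac)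
  also have "1 + (1 - of_real (q/p)) * of_real (p * s * ?x) = 1 + complex_of_real ((p - q) * s * ?x)"
    using assms by (simp add: field_simps)
  finally have "?E j = (1 + of_real ((p - q) * s * ?x)) * ?E (j + 1)" .
  then show ?thesis
    using nonzero[of j] nonzero[of "j + 1"]
    unfolding pq_node_recip_E_def by (simp add: divide_simps)
qed

text \<open>The nodes tend to 0 as the index grows, and E is continuous with E(0) = 1.\<close>

lemma pq_node_recip_E_at_top:
  assumes "0 < q" "q < p"
  shows "(\<lambda>k. pq_node_recip_E p q s (int k)) \<longlonglongrightarrow> 1"
proof -
  have "(\<lambda>k. (q/p) ^ k) \<longlonglongrightarrow> 0"
    using assms by (intro LIMSEQ_realpow_zero) auto
  then have "(\<lambda>k. complex_of_real (p * s * ((q/p) ^ k / p))) \<longlonglongrightarrow> of_real (p * s * (0 / p))"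
    using assms by (intro tendsto_intros) auto
  then have "(\<lambda>k. complex_of_real (p * s * pq_node p q (int k))) \<longlonglongrightarrow> 0"
    by (simp add: pq_node_eq[OF assms])
  from isCont_tendsto_compose[OF isCont_pq_E[OF assms] this]
  have "(\<lambda>k. 1 / pq_E p q (of_real (p * s * pq_node p q (int k)))) \<longlonglongrightarrow> 1 / pq_E p q 0"
    by (intro tendsto_intros) auto
  then show ?thesis
    by (simp add: pq_node_recip_E_def)
qed

text \<open>At index -k the argument of E is s / r^k, so the linear lower bound for E gives |G|
  \<le> r^k / s.\<close>

lemma pq_node_recip_E_at_bot:
  assumes "0 < q" "q < p" "0 < s"
  shows "(\<lambda>k. pq_node_recip_E p q s (- int k)) \<longlonglongrightarrow> 0"
proof (rule tendsto_0_le)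
  have "(\<lambda>k. (q/p) ^ k) \<longlonglongrightarrow> 0"
    using assms by (intro LIMSEQ_realpow_zero) auto
  from tendsto_divide[OF this tendsto_const[of s]] assms
  show "(\<lambda>k. (q/p) ^ k / s) \<longlonglongrightarrow> 0"
    by simp
  have "cmod (pq_node_recip_E p q s (- int k)) \<le> (q/p) ^ k / s" for k
  proof -
    have node: "p * s * pq_node p q (- int k) = s / (q/p) ^ k"
      using assms by (simp add: pq_node_eq power_int_minus field_simps)
    have "0 < s / (q/p) ^ k"
      using assms by simp
    moreover from this have "s / (q/p) ^ k \<le> cmod (pq_E p q (of_real (s / (q/p) ^ k)))"
      using norm_pq_E_ge[OF assms(1,2), of "s / (q/p) ^ k"] by linarith
    ultimately have "1 / cmod (pq_E p q (of_real (s / (q/p) ^ k))) \<le> 1 / (s / (q/p) ^ k)"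
      by (rule frac_le[OF zero_le_one order_refl])
    then show ?thesis
      unfolding pq_node_recip_E_def node norm_divide by simp
  qed
  then show "\<forall>\<^sub>F k in sequentially. cmod (pq_node_recip_E p q s (- int k)) \<le> norm ((q/p) ^ k / s) * 1"
    using assms by simp
qed

section \<open>Moments of the kernel by induction\<close>

text \<open>The node weight in \<open>pq_term\<close> raises the exponent from n to
  \<open>Suc n\<close>.\<close>

lemma pq_term_laplace_power:
  assumes "0 < q" "q < p"
  shows "pq_term p q (pq_laplace_integrand p q (\<lambda>t. complex_of_real t ^ n) s) j =
    of_real (pq_node p q j ^ Suc n) * pq_node_recip_E p q s j"
  by (simp add: pq_term_def pq_laplace_integrand_def pq_e_eq[OF assms] pq_node_recip_E_def mult_ac)

text \<open>The factor p - q in the denominator appears because the prefactor of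
  \<open>pq_integral\<close> is left out. In the induction step the next sum is a combination of the
  present one and its shift, so its convergence comes with its value.\<close>

lemma has_bilateral_sum_laplace_power:
  assumes "0 < q" "q < p" "0 < s"
  shows "has_bilateral_sum (\<lambda>j. of_real (pq_node p q j ^ Suc n) * pq_node_recip_E p q s j)
    (of_real (pq_fact p q n / ((p - q) * (q ^ (Suc n choose 2) * s ^ Suc n))))"
proof (induction n)
  case 0
  let ?G = "pq_node_recip_E p q s" and ?c = "complex_of_real ((p - q) * s)"
  have "has_bilateral_sum (\<lambda>j. ?G (j + 1) - ?G j) (1 - 0)"
    by (intro has_bilateral_sum_telescope pq_node_recip_E_at_top pq_node_recip_E_at_bot assms)
  from has_bilateral_sum_mult[OF this, of "1 / ?c"]
  have "has_bilateral_sum (\<lambda>j. 1 / ?c * (of_real ((p - q) * s * pq_node p q j) * ?G j)) (1 / ?c)"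
    by (simp add: pq_node_recip_E_diff[OF assms])
  moreover have "1 / ?c * (of_real ((p - q) * s * pq_node p q j) * ?G j)
      = of_real (pq_node p q j) * ?G j" for j
    using assms by simp
  ultimately show ?case
    by (simp add: binomial_eq_0)
next
  case (Suc n)
  let ?G = "pq_node_recip_E p q s" and ?x = "pq_node p q" and ?c = "complex_of_real ((p - q) * s)"
  \<comment> \<open>Chosen to offset x (j + 1) = (q/p) x j in the power \<open>Suc n\<close>:
    \<open>?u * ?T (j + 1) - ?T j\<close> then isolates the difference of G.\<close>
  let ?u = "complex_of_real ((p/q) ^ Suc n)"
  let ?S = "complex_of_real (pq_fact p q n / ((p - q) * (q ^ (Suc n choose 2) * s ^ Suc n)))"
  let ?T = "\<lambda>j. of_real (?x j ^ Suc n) * ?G j"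
  have c: "?c \<noteq> 0"
    using assms by simp
  have "has_bilateral_sum (\<lambda>j. 1 / ?c * (?u * ?T (j + 1) - ?T j)) (1 / ?c * (?u * ?S - ?S))"
    by (intro has_bilateral_sum_mult has_bilateral_sum_diff has_bilateral_sum_shift Suc)
  moreover have "1 / ?c * (?u * ?T (j + 1) - ?T j) = of_real (?x j ^ Suc (Suc n)) * ?G j" for j
  proof -
    have "(p/q) ^ Suc n * ?x (j + 1) ^ Suc n = ?x j ^ Suc n"
      unfolding power_mult_distrib[symmetric] using assms by (simp add: pq_node_add_one)
    then have "?u * of_real (?x (j + 1) ^ Suc n) = of_real (?x j ^ Suc n)"
      by (metis of_real_mult)
    then have "?u * ?T (j + 1) - ?T j = of_real (?x j ^ Suc n) * (?G (j + 1) - ?G j)"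
      unfolding right_diff_distrib mult.assoc[symmetric] by simp
    also have "\<dots> = ?c * (of_real (?x j ^ Suc (Suc n)) * ?G j)"
      by (simp add: pq_node_recip_E_diff[OF assms] mult_ac)
    finally show ?thesis
      using c by simp
  qed
  moreover have "1 / ?c * (?u * ?S - ?S) =
      of_real (pq_fact p q (Suc n) / ((p - q) * (q ^ (Suc (Suc n) choose 2) * s ^ Suc (Suc n))))"
  proof -
    define A where "A = (p - q) * (q ^ (Suc n choose 2) * s ^ Suc n)"
    have A: "A \<noteq> 0"
      using assms by (simp add: A_def)
    have "(p - q) * (q ^ (Suc (Suc n) choose 2) * s ^ Suc (Suc n)) = A * (q ^ Suc n * s)"
      unfolding A_def Suc_choose_two[of "Suc n"] power_add by (simp add: mult_ac)
    \<comment> \<open>The point is ((p/q)^(n+1) - 1) / (p - q) = [n+1] / q^(n+1), which supplies the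
      new factor of the factorial and the growth n + 1 of the exponent of q.\<close>
    moreover have "1 / ((p - q) * s) * ((p/q) ^ Suc n * (pq_fact p q n / A) - pq_fact p q n / A)
        = pq_number p q (Suc n) * pq_fact p q n / (A * (q ^ Suc n * s))"
      using A assms unfolding pq_number_def power_divide
      by (simp add: divide_simps del: power_Suc) (simp add: algebra_simps)
    ultimately have "1 / ((p - q) * s) * ((p/q) ^ Suc n * (pq_fact p q n / A) - pq_fact p q n / A)
        = pq_fact p q (Suc n) / ((p - q) * (q ^ (Suc (Suc n) choose 2) * s ^ Suc (Suc n)))"
      by (simp only: pq_fact_Suc)
    from arg_cong[OF this, of complex_of_real] show ?thesis
      unfolding A_def[symmetric] by (simp only: of_real_mult of_real_divide of_real_diff of_real_1)
  qed
  ultimately show ?case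
    by simp
qed

theorem proposition3p6:
  fixes p q s :: real and n :: nat
  assumes "0 < q" and "q < p" and "0 < s"
  shows "pq_integrable p q (pq_laplace_integrand p q (\<lambda>t. complex_of_real t ^ n) s) \<and>
    pq_laplace p q (\<lambda>t. complex_of_real t ^ n) s =
      complex_of_real (pq_fact p q n / (q ^ ((n + 1) choose 2) * s ^ (n + 1)))"
proof -
  let ?f = "pq_laplace_integrand p q (\<lambda>t. complex_of_real t ^ n) s"
  let ?D = "q ^ (Suc n choose 2) * s ^ Suc n"
  have "has_bilateral_sum (pq_term p q ?f) (of_real (pq_fact p q n / ((p - q) * ?D)))"
    using has_bilateral_sum_laplace_power[OF assms, of n]
    by (subst ext[OF pq_term_laplace_power[OF assms(1,2)]])
  then obtain a b where ab: "(\<lambda>k. pq_term p q ?f (int k)) sums a"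
      "(\<lambda>k. pq_term p q ?f (- int k - 1)) sums b"
      "of_real (pq_fact p q n / ((p - q) * ?D)) = a + b"
    by (auto simp: has_bilateral_sum_def)
  have "pq_laplace p q (\<lambda>t. complex_of_real t ^ n) s = of_real (p - q) * (a + b)"
    unfolding pq_laplace_def pq_integral_def using ab(1,2) by (simp add: sums_iff)
  also have "\<dots> = of_real ((p - q) * (pq_fact p q n / ((p - q) * ?D)))"
    by (simp only: ab(3)[symmetric] of_real_mult)
  also have "(p - q) * (pq_fact p q n / ((p - q) * ?D)) = pq_fact p q n / ?D"
    using assms by simp
  finally show ?thesis
    using ab(1,2) by (simp add: pq_integrable_def sums_iff)
qed

end
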